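(* Let $n,m$ be positive integers such that $1<m<n$. Let $k=n-m$ and let $\overline{G}_{n,m}=(U,V;E)$ be the bipartite graph with $U=\{u_i \mid i\in[n]\}$, $V=\{v_j\mid j\in[m]\}$ and $$E=\left\{(u_{(i-\beta)\bmod n},v_j)\;\middle|\; j\in[m],\ \beta\in[k+1],\ i=\left\lfloor \frac{jn}{m}\right\rfloor\right\}.$$ Then the following properties hold: \begin{itemize} \item $\kappa_V(\overline{G}_{n,m})\in\{k,k+1\}$, \item $\kappa_U(\overline{G}_{n,m})=\delta_U(\overline{G}_{n,m})$, \item $\kappa(\overline{G}_{n,m})=\delta(\overline{G}_{n,m})$. \end{itemize} Moreover, $\kappa_V(\overline{G}_{n,m})=k$ if $k=1$.
   Context: For a positive integer $o$, $[o]=\{0,1,\ldots,o-1\}$. All graphs are finite, simple and undirected. $G=(U,V;E)$ denotes a bipartite graph with color classes $U,V$ and edge set $E$. $\delta(G)$ denotes the minimum degree of $G$ and $\delta_U(G)$ the minimum degree in $G$ of a vertex in $U$. A graph is $t$-connected if it has more than $t$ vertices and remains connected whenever strictly fewer than $t$ vertices are removed; the connectivity $\kappa(G)$ is the maximum $t$ such that $G$ is $t$-connected. A vertex cut separating two vertices $u,v$ of the same component of $G$ is a set $Z$ of vertices of $G$ whose removal leaves $u$ and $v$ (neither in $Z$) in different components of $G-Z$. For a set $S$ of vertices of $G$, the set connectivity $\kappa_S(G)$ is the size of a smallest vertex cut separating some two vertices $u,v\in S$; $\kappa_U(G)$ and $\kappa_V(G)$ are the set connectivities of the color classes $U$ and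 $V$. *)

theory Defs
  imports "Graph_Theory.Graph_Theory" "HOL-Library.Extended_Nat"
begin

text \<open>
  Finite simple undirected graphs are the symmetric, loop-free digraphs of locale
  \<^locale>\<open>graph\<close>: an undirected edge is a pair of opposite arcs, so the degree of a vertex is its
  out-degree, and two vertices lie in the same component iff one is reachable from the other.
\<close>

definition delete_verts :: "('a, 'b) pre_digraph \<Rightarrow> 'a set \<Rightarrow> ('a, 'b) pre_digraph" where
  "delete_verts G Z = G \<restriction> (verts G - Z)"

definition min_degree_on :: "('a, 'b) pre_digraph \<Rightarrow> 'a set \<Rightarrow> nat" where
  "min_degree_on G S = Min (out_degree G ` S)"

definition min_degree :: "('a, 'b) pre_digraph \<Rightarrow> nat" where
  "min_degree G = min_degree_on G (verts G)"

definition t_connected :: "nat \<Rightarrow> ('a, 'b) pre_digraph \<Rightarrow> bool" where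
  "t_connected t G \<longleftrightarrow>
     t < card (verts G) \<and>
     (\<forall>Z \<subseteq> verts G. card Z < t \<longrightarrow> Digraph_Component.connected (delete_verts G Z))"

text \<open>The bound \<open>t < card (verts G)\<close> makes the set below finite; for a nonempty graph it contains 0.\<close>

definition connectivity :: "('a, 'b) pre_digraph \<Rightarrow> nat" where
  "connectivity G = Max {t. t_connected t G}"

definition vertex_cut :: "('a, 'b) pre_digraph \<Rightarrow> 'a \<Rightarrow> 'a \<Rightarrow> 'a set \<Rightarrow> bool" where
  "vertex_cut G u v Z \<longleftrightarrow>
     Z \<subseteq> verts G \<and> u \<in> verts G - Z \<and> v \<in> verts G - Z \<and>
     u \<rightarrow>\<^sup>*\<^bsub>G\<^esub> v \<and> \<not> u \<rightarrow>\<^sup>*\<^bsub>delete_verts G Z\<^esub> v"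

text \<open>Extended naturals, so that the value is \<open>\<infinity>\<close> (and not 0) if no two vertices of \<open>S\<close> can be
  separated.\<close>

definition set_connectivity :: "('a, 'b) pre_digraph \<Rightarrow> 'a set \<Rightarrow> enat" where
  "set_connectivity G S = (INF Z \<in> {Z. \<exists>u\<in>S. \<exists>v\<in>S. vertex_cut G u v Z}. enat (card Z))"

text \<open>The vertices \<open>u\<^sub>i\<close> and \<open>v\<^sub>j\<close> are \<open>Inl i\<close> and \<open>Inr j\<close>.\<close>

definition U_class :: "nat \<Rightarrow> (nat + nat) set" where
  "U_class n = Inl ` {..<n}"

definition V_class :: "nat \<Rightarrow> (nat + nat) set" where
  "V_class m = Inr ` {..<m}"

text \<open>The index \<open>i - \<beta>\<close> may be negative, so it is reduced modulo \<open>n\<close> over the integers.\<close>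

definition E_bar :: "nat \<Rightarrow> nat \<Rightarrow> ((nat + nat) \<times> (nat + nat)) set" where
  "E_bar n m =
     {(Inl (nat ((i - int \<beta>) mod int n)), Inr j) | i j \<beta>.
        j \<in> {..<m} \<and> \<beta> \<in> {..<(n - m) + 1} \<and> i = \<lfloor>real (j * n) / real m\<rfloor>}"

definition G_bar :: "nat \<Rightarrow> nat \<Rightarrow> (nat + nat) pair_pre_digraph" where
  "G_bar n m = \<lparr>pverts = U_class n \<union> V_class m, parcs = E_bar n m \<union> (E_bar n m)\<inverse>\<rparr>"

lemma E_bar_bipartite:
  assumes "0 < n"
  shows "E_bar n m \<subseteq> U_class n \<times> V_class m"
  using assms by (auto simp: E_bar_def U_class_def V_class_def nat_less_iff)

lemma pair_graph_G_bar:
  assumes "0 < n"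
  shows "pair_graph (G_bar n m)"
proof -
  have sub: "parcs (G_bar n m) \<subseteq> U_class n \<times> V_class m \<union> V_class m \<times> U_class n"
    using E_bar_bipartite[OF assms, of m] by (auto simp: G_bar_def)
  have "finite (U_class n)" "finite (V_class m)"
    by (auto simp: U_class_def V_class_def)
  then have fin: "finite (pverts (G_bar n m))" "finite (parcs (G_bar n m))"
    using finite_subset[OF sub] by (auto simp: G_bar_def)
  have wf: "e \<in> parcs (G_bar n m) \<Longrightarrow> fst e \<in> pverts (G_bar n m) \<and> snd e \<in> pverts (G_bar n m)" for e
    using sub by (auto simp: G_bar_def)
  have loop: "e \<in> parcs (G_bar n m) \<Longrightarrow> fst e \<noteq> snd e" for e
    using sub by (auto simp: U_class_def V_class_def)
  have "symmetric (with_proj (G_bar n m))"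
    by (auto simp: symmetric_def sym_def G_bar_def)
  with fin wf loop show ?thesis
    by unfold_locales blast+
qed

end

theory Submission
  imports Defs
begin

text \<open>
  The neighbourhood of \<open>v\<^sub>j\<close> is an interval of \<open>k + 1\<close> points on a cycle of length \<open>n = m + k\<close>, so every
  nonempty \<open>X \<subseteq> V\<close> satisfies \<open>|N X| \<ge> min n (|X| + k)\<close>.

  If deleting \<open>Z\<close> splits the rest of \<open>V\<close> into \<open>X\<close> and \<open>Y\<close>, then \<open>N X \<inter> N Y \<subseteq> Z\<close>, and
  \<open>|N X \<inter> N Y| \<ge> |N X| + |N Y| - n\<close> gives \<open>|Z| \<ge> k\<close>. If it splits the rest of \<open>U\<close> into \<open>P\<close> and \<open>Q\<close>, then
  expansion of the set of vertices of \<open>V\<close> without a neighbour in \<open>P\<close> (or in \<open>Q\<close>) bounds its size, and \<open>Z\<close>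
  contains every vertex of \<open>V\<close> with neighbours in both; this gives \<open>|Z| \<ge> min \<delta>\<^sub>U k\<close>. Double counting edges
  gives \<open>\<delta>\<^sub>U \<le> k\<close>.
\<close>

section \<open>Reachability after deleting vertices\<close>

lemma (in wf_digraph) dominates_delete_verts_iff:
  "x \<rightarrow>\<^bsub>delete_verts G Z\<^esub> y \<longleftrightarrow> x \<rightarrow>\<^bsub>G\<^esub> y \<and> x \<notin> Z \<and> y \<notin> Z"
proof -
  have "x \<rightarrow>\<^bsub>delete_verts G Z\<^esub> y \<longleftrightarrow>
      (\<exists>e\<in>arcs G. tail G e = x \<and> head G e = y) \<and> x \<in> verts G - Z \<and> y \<in> verts G - Z"
    unfolding arcs_ends_conv delete_verts_def by auto
  also have "\<dots> \<longleftrightarrow> x \<rightarrow>\<^bsub>G\<^esub> y \<and> x \<notin> Z \<and> y \<notin> Z"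
    unfolding arcs_ends_conv by auto
  finally show ?thesis .
qed

lemma verts_delete_verts [simp]: "verts (delete_verts G Z) = verts G - Z"
  by (simp add: delete_verts_def)

context wf_digraph
begin

lemma wf_digraph_delete_verts: "wf_digraph (delete_verts G Z)"
  unfolding delete_verts_def by (rule wellformed_induce_subgraph)

text \<open>Induction along the walk. A closed set holding \<open>a\<close> but not \<open>b\<close>
  thus certifies that \<open>Z\<close> separates them.\<close>

lemma reachable_delete_verts_closed:
  assumes "a \<rightarrow>\<^sup>*\<^bsub>delete_verts G Z\<^esub> b" and "a \<in> S"
    and "\<And>x y. x \<in> S \<Longrightarrow> y \<notin> Z \<Longrightarrow> x \<rightarrow>\<^bsub>G\<^esub> y \<Longrightarrow> y \<in> S"
  shows "b \<in> S"
  using wf_digraph.reachable_induct[OF wf_digraph_delete_verts assms(1), of "\<lambda>x. x \<in> S"] assms(2,3)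
  by (auto simp: dominates_delete_verts_iff)

text \<open>The converse certificate: \<open>S\<close> is the set of all vertices reachable from
  \<open>a\<close>. It turns a separation into a closed set whose traces on the two colour classes
  can be counted.\<close>

lemma not_reachable_delete_vertsE:
  assumes "a \<in> verts G - Z" and "\<not> a \<rightarrow>\<^sup>*\<^bsub>delete_verts G Z\<^esub> b"
  obtains S where "a \<in> S" "b \<notin> S" "S \<subseteq> verts G - Z"
    "\<forall>x y. x \<in> S \<longrightarrow> y \<notin> Z \<longrightarrow> x \<rightarrow>\<^bsub>G\<^esub> y \<longrightarrow> y \<in> S"
proof
  interpret D: wf_digraph "delete_verts G Z" by (rule wf_digraph_delete_verts)
  let ?S = "{x. a \<rightarrow>\<^sup>*\<^bsub>delete_verts G Z\<^esub> x}"
  have verts: "x \<in> verts G - Z" if "x \<in> ?S" for x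
    using D.reachable_in_verts(2)[of a x] that by simp
  show "a \<in> ?S" using D.reachable_refl[of a] assms(1) by simp
  show "b \<notin> ?S" using assms(2) by simp
  show "?S \<subseteq> verts G - Z" using verts by blast
  show "\<forall>x y. x \<in> ?S \<longrightarrow> y \<notin> Z \<longrightarrow> x \<rightarrow>\<^bsub>G\<^esub> y \<longrightarrow> y \<in> ?S"
  proof (intro allI impI)
    fix x y assume "x \<in> ?S" "y \<notin> Z" "x \<rightarrow>\<^bsub>G\<^esub> y"
    moreover from this have "x \<rightarrow>\<^bsub>delete_verts G Z\<^esub> y"
      using verts[of x] by (simp add: dominates_delete_verts_iff)
    ultimately show "y \<in> ?S" using D.reachable_adj_trans[of a x y] by simp
  qed
qed

lemma not_reachable_delete_neighbours:
  assumes "a \<noteq> b"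
  shows "\<not> a \<rightarrow>\<^sup>*\<^bsub>delete_verts G {y. a \<rightarrow>\<^bsub>G\<^esub> y}\<^esub> b"
  using reachable_delete_verts_closed[where S = "{a}"] assms by auto

end

text \<open>Library connectedness refers to the symmetric closure. Deleting vertices preserves
  symmetry, so it agrees with strong connectedness here, which includes nonemptiness.\<close>

lemma (in sym_digraph) connected_delete_verts_iff:
  "Digraph_Component.connected (delete_verts G Z) \<longleftrightarrow>
     verts G - Z \<noteq> {} \<and>
     (\<forall>a\<in>verts G - Z. \<forall>b\<in>verts G - Z. a \<rightarrow>\<^sup>*\<^bsub>delete_verts G Z\<^esub> b)"
proof -
  interpret D: wf_digraph "delete_verts G Z" by (rule wf_digraph_delete_verts)
  have "symmetric (delete_verts G Z)"
    using sym_arcs by (auto simp: symmetric_def sym_def dominates_delete_verts_iff)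
  then have "Digraph_Component.connected (delete_verts G Z) \<longleftrightarrow> strongly_connected (delete_verts G Z)"
    using D.symmetric_connected_imp_strongly_connected D.reachable_mk_symmetricI
    by (auto simp: strongly_connected_def intro!: D.connectedI)
  then show ?thesis by (simp add: strongly_connected_def)
qed

lemma delete_verts_empty [simp]:
  "wf_digraph G \<Longrightarrow> delete_verts G {} = G"
  by (cases G) (auto simp: delete_verts_def induce_subgraph_def wf_digraph_def)

lemma set_connectivity_ge:
  assumes "\<And>u v Z. u \<in> S \<Longrightarrow> v \<in> S \<Longrightarrow> vertex_cut G u v Z \<Longrightarrow> c \<le> card Z"
  shows "enat c \<le> set_connectivity G S"
  unfolding set_connectivity_def using assms by (intro INF_greatest) auto

lemma set_connectivity_le:
  assumes "u \<in> S" "v \<in> S" "vertex_cut G u v Z"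
  shows "set_connectivity G S \<le> enat (card Z)"
  unfolding set_connectivity_def using assms by (intro INF_lower) auto

section \<open>Bipartite graphs whose neighbourhoods expand\<close>

text \<open>All connectivity bounds follow from these counting assumptions; the cyclic structure
  enters only later, when \<open>expansion\<close> is verified.\<close>

locale expanding_bipartite =
  fixes U :: "'a set" and V :: "'b set" and N :: "'b \<Rightarrow> 'a set" and k :: nat
  assumes finite_U: "finite U" and finite_V: "finite V"
    and card_V: "2 \<le> card V" and k_pos: "0 < k"
    and card_U: "card U = card V + k"
    and N_subset: "v \<in> V \<Longrightarrow> N v \<subseteq> U"
    and card_N: "v \<in> V \<Longrightarrow> card (N v) \<le> k + 1"
    and expansion: "X \<subseteq> V \<Longrightarrow> X \<noteq> {} \<Longrightarrow> min (card U) (card X + k) \<le> card (\<Union> (N ` X))"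
begin

text \<open>Expansion of the singleton \<open>{v}\<close> supplies the missing lower bound.\<close>

lemma card_N_eq: "v \<in> V \<Longrightarrow> card (N v) = k + 1"
  using expansion[of "{v}"] card_N[of v] card_U card_V by auto

lemma UN_N: "\<Union> (N ` V) = U"
proof (rule card_subset_eq[OF finite_U])
  show "\<Union> (N ` V) \<subseteq> U" using N_subset by blast
  then have "card (\<Union> (N ` V)) \<le> card U" using finite_U card_mono by blast
  moreover have "V \<noteq> {}" using card_V by auto
  ultimately show "card (\<Union> (N ` V)) = card U" using expansion[of V] card_U by auto
qed

section \<open>Degrees in \<open>U\<close>\<close>

definition deg :: "'a \<Rightarrow> nat" where
  "deg u = card {v \<in> V. u \<in> N v}"

lemma deg_pos: "u \<in> U \<Longrightarrow> 0 < deg u"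
  using UN_N finite_V by (auto simp: deg_def card_gt_0_iff)

lemma sum_deg: "(\<Sum>u\<in>U. deg u) = card V * (k + 1)"
proof -
  have "{u \<in> U. u \<in> N v} = N v" if "v \<in> V" for v
    using N_subset[OF that] by blast
  then have "(\<Sum>u\<in>U. deg u) = (\<Sum>v\<in>V. k + 1)"
    unfolding deg_def using finite_U finite_V card_N_eq by (intro sum_multicount_gen) auto
  then show ?thesis by simp
qed

definition d :: nat where
  "d = Min (deg ` U)"

lemma U_nonempty: "U \<noteq> {}"
  using card_U k_pos by auto

lemma d_le_deg: "u \<in> U \<Longrightarrow> d \<le> deg u"
  using finite_U by (simp add: d_def)

lemma d_attained: obtains u where "u \<in> U" "deg u = d"
proof -
  have "d \<in> deg ` U" using Min_in[of "deg ` U"] finite_U U_nonempty by (simp add: d_def)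
  then show thesis by (rule imageE) (simp add: that)
qed

lemma d_pos: "0 < d"
proof -
  obtain u where "u \<in> U" "deg u = d" by (rule d_attained)
  then show ?thesis using deg_pos[of u] by simp
qed

text \<open>If all degrees in \<open>U\<close> exceeded \<open>k\<close>, the edge count
  \<open>card V * (k + 1)\<close> would be at least \<open>card U * (k + 1)\<close>, although
  \<open>U\<close> is larger than \<open>V\<close>.\<close>

lemma d_le_k: "d \<le> k"
proof (rule ccontr)
  assume "\<not> d \<le> k"
  then have "k + 1 \<le> deg u" if "u \<in> U" for u using d_le_deg[OF that] by simp
  then have "card U * (k + 1) \<le> (\<Sum>u\<in>U. deg u)" by (metis sum_bounded_below of_nat_id)
  then have "card U \<le> card V" unfolding sum_deg by (rule mult_right_le_imp_le) simp
  then show False using card_U k_pos by simp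
qed

section \<open>Counting bounds for separated pairs\<close>

text \<open>Expansion gives |A| + |B| \<ge> |X| + |Y| + 2k for the two neighbourhoods, while their
  union has at most |V| + k points. Inclusion-exclusion leaves an intersection of at least k - |V -
  X - Y|.\<close>

lemma card_common_neighbours_ge:
  assumes "X \<subseteq> V" "Y \<subseteq> V" "X \<noteq> {}" "Y \<noteq> {}" "X \<inter> Y = {}"
  shows "k \<le> card (\<Union> (N ` X) \<inter> \<Union> (N ` Y)) + card (V - X - Y)"
proof -
  let ?A = "\<Union> (N ` X)" and ?B = "\<Union> (N ` Y)"
  have sub: "?A \<subseteq> U" "?B \<subseteq> U" using assms N_subset by blast+
  then have fin: "finite ?A" "finite ?B" using finite_U finite_subset by blast+
  have "card (?A \<union> ?B) \<le> card U" using sub finite_U by (intro card_mono) auto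
  moreover have "card ?A + card ?B = card (?A \<union> ?B) + card (?A \<inter> ?B)"
    using fin by (rule card_Un_Int)
  moreover have "card X + card Y + card (V - X - Y) = card V"
  proof -
    have "card (X \<union> Y) = card X + card Y"
      using assms finite_V finite_subset by (intro card_Un_disjoint) blast+
    moreover have "V - X - Y = V - (X \<union> Y)" by blast
    moreover have "card (V - (X \<union> Y)) = card V - card (X \<union> Y)" "card (X \<union> Y) \<le> card V"
      using assms finite_V finite_subset by (auto intro!: card_Diff_subset card_mono)
    ultimately show ?thesis by simp
  qed
  ultimately show ?thesis
    using expansion[of X] expansion[of Y] assms card_U by linarith
qed

lemma card_separated_V_ge:
  assumes "P \<subseteq> U" "Q \<subseteq> U" "P \<noteq> {}" "Q \<noteq> {}" "P \<inter> Q = {}"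
  shows "d \<le> card {v \<in> V. N v \<inter> P \<noteq> {} \<and> N v \<inter> Q \<noteq> {}} + card (U - P - Q)"
proof -
  let ?T = "{v \<in> V. N v \<inter> P \<noteq> {} \<and> N v \<inter> Q \<noteq> {}}"
  let ?L = "{v \<in> V. N v \<inter> P = {}}" and ?M = "{v \<in> V. N v \<inter> Q = {}}"
  have fin: "finite P" "finite Q" using assms finite_U finite_subset by blast+
  \<comment> \<open>If every vertex of \<open>V\<close> meets \<open>R\<close>, then each neighbour
    of \<open>r\<close> meets both sides, so \<open>deg r\<close> bounds the left term. The
    doubleton equation covers both orders of \<open>P\<close> and \<open>Q\<close>.\<close>
  have all: "d \<le> card ?T" if "\<forall>v\<in>V. N v \<inter> R \<noteq> {}" "r \<in> R'" "{R, R'} = {P, Q}" for R R' r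
  proof -
    have "r \<in> U" "{v \<in> V. r \<in> N v} \<subseteq> ?T" using that assms by (auto simp: doubleton_eq_iff)
    then show ?thesis
      using d_le_deg[of r] card_mono[of ?T "{v \<in> V. r \<in> N v}"] finite_V by (simp add: deg_def)
  qed
  \<comment> \<open>The neighbourhoods of vertices avoiding \<open>R\<close> lie in
    \<open>U - R\<close>, so expansion limits how many such vertices there are.\<close>
  have avoid: "card {v \<in> V. N v \<inter> R = {}} + k + card R \<le> card U"
    if R: "R \<subseteq> U" "R \<noteq> {}" and ne: "{v \<in> V. N v \<inter> R = {}} \<noteq> {}" for R
  proof -
    let ?W = "{v \<in> V. N v \<inter> R = {}}"
    have "\<Union> (N ` ?W) \<subseteq> U - R" using N_subset by blast
    then have "card (\<Union> (N ` ?W)) \<le> card (U - R)" using finite_U by (intro card_mono) auto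
    also have "\<dots> = card U - card R" using R finite_U finite_subset by (intro card_Diff_subset) auto
    finally have "card (\<Union> (N ` ?W)) \<le> card U - card R" .
    \<comment> \<open>Positivity of \<open>card R\<close> excludes the case in which the minimum in
      \<open>expansion\<close> is \<open>card U\<close>.\<close>
    moreover have "card R \<le> card U" "0 < card R"
      using R finite_U finite_subset by (auto intro: card_mono simp: card_gt_0_iff)
    ultimately show ?thesis using expansion[of ?W] ne by auto
  qed
  consider "?L = {}" | "?M = {}" | "?L \<noteq> {}" "?M \<noteq> {}" by blast
  then show ?thesis
  proof cases
    case 1
    then show ?thesis using all[of P _ Q] assms(4) by fastforce
  next
    case 2
    then show ?thesis using all[of Q _ P] assms(3) by fastforce
  next
    case 3
    have "V = ?T \<union> ?L \<union> ?M" by blast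
    then have "card V \<le> card ?T + card ?L + card ?M"
      by (metis (no_types, lifting) card_Un_le add_le_cancel_right le_trans)
    moreover have "card (U - P - Q) = card U - card P - card Q" "card P + card Q \<le> card U"
    proof -
      have *: "card (P \<union> Q) = card P + card Q" using fin assms by (intro card_Un_disjoint) auto
      then show "card P + card Q \<le> card U" using assms finite_U by (metis card_mono Un_least)
      have "U - P - Q = U - (P \<union> Q)" by blast
      then show "card (U - P - Q) = card U - card P - card Q"
        using * assms fin by (simp add: card_Diff_subset)
    qed
    \<comment> \<open>By \<open>avoid\<close>, |L| \<le> |V| - |P| and |M| \<le> |V| - |Q|, hence
      |T| \<ge> |P| + |Q| - |V|. Adding |U - P - Q| = |V| + k - |P| - |Q| gives at least k, and
      \<open>d_le_k\<close> finishes.\<close>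
    ultimately show ?thesis
      using avoid[of P] avoid[of Q] 3 assms card_U d_le_k by linarith
  qed
qed


section \<open>The graph of the neighbourhood system\<close>

definition edges :: "(('a + 'b) \<times> ('a + 'b)) set" where
  "edges = {(Inl u, Inr v) | u v. v \<in> V \<and> u \<in> N v}"

text \<open>Built in the same form as \<open>G_bar\<close>, so that the two can be identified by
  unfolding.\<close>

definition H :: "('a + 'b) pair_pre_digraph" where
  "H = \<lparr>pverts = Inl ` U \<union> Inr ` V, parcs = edges \<union> edges\<inverse>\<rparr>"

lemma verts_H: "pverts H = Inl ` U \<union> Inr ` V"
  by (simp add: H_def)

lemma adj_H:
  "(Inl u, Inr v) \<in> parcs H \<longleftrightarrow> v \<in> V \<and> u \<in> N v"
  "(Inr v, Inl u) \<in> parcs H \<longleftrightarrow> v \<in> V \<and> u \<in> N v"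
  "(Inl u, Inl u') \<notin> parcs H"
  "(Inr v, Inr v') \<notin> parcs H"
  by (auto simp: H_def edges_def)

sublocale H: graph "with_proj H"
proof -
  have "edges \<subseteq> Inl ` U \<times> Inr ` V" using N_subset by (auto simp: edges_def)
  then have sub: "parcs H \<subseteq> Inl ` U \<times> Inr ` V \<union> Inr ` V \<times> Inl ` U"
    by (auto simp: H_def)
  have fin: "finite (pverts H)" "finite (parcs H)"
    using finite_subset[OF sub] finite_U finite_V by (auto simp: H_def)
  have wf: "e \<in> parcs H \<Longrightarrow> fst e \<in> pverts H \<and> snd e \<in> pverts H" for e
    using sub by (auto simp: H_def)
  have loop: "e \<in> parcs H \<Longrightarrow> fst e \<noteq> snd e" for e
    using sub by auto
  have "symmetric (with_proj H)"
    by (auto simp: symmetric_def sym_def H_def)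
  with fin wf loop interpret P: pair_graph H
    by unfold_locales blast+
  show "graph (with_proj H)" by unfold_locales
qed

lemma neighbours_Inl: "{y. (Inl u, y) \<in> parcs H} = Inr ` {v \<in> V. u \<in> N v}"
  by (auto simp: H_def edges_def)

lemma neighbours_Inr: "v \<in> V \<Longrightarrow> {y. (Inr v, y) \<in> parcs H} = Inl ` N v"
  by (auto simp: H_def edges_def)

lemma out_degree_Inl: "out_degree H (Inl u) = deg u"
proof -
  have "out_arcs H (Inl u) = (\<lambda>v. (Inl u, Inr v)) ` {v \<in> V. u \<in> N v}"
    by (auto simp: out_arcs_def H_def edges_def)
  then show ?thesis by (simp add: out_degree_def deg_def card_image inj_on_def)
qed

lemma out_degree_Inr: "v \<in> V \<Longrightarrow> out_degree H (Inr v) = k + 1"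
proof -
  assume v: "v \<in> V"
  have "out_arcs H (Inr v) = (\<lambda>u. (Inr v, Inl u)) ` N v"
    using v by (auto simp: out_arcs_def H_def edges_def)
  then show ?thesis using card_N_eq[OF v] by (simp add: out_degree_def card_image inj_on_def)
qed

lemma min_degree_on_U: "min_degree_on H (Inl ` U) = d"
  unfolding min_degree_on_def d_def by (simp add: image_image out_degree_Inl)

text \<open>Vertices of \<open>V\<close> have degree \<open>k + 1\<close>, which exceeds
  \<open>d\<close>, so the minimum is attained in \<open>U\<close>.\<close>

lemma min_degree_H: "min_degree H = d"
  unfolding min_degree_def min_degree_on_def
proof (rule Min_eqI)
  show "finite (out_degree H ` verts H)" using finite_U finite_V by (simp add: verts_H)
  show "d \<le> y" if "y \<in> out_degree H ` verts H" for y
    using that d_le_deg le_SucI[OF d_le_k] by (auto simp: verts_H out_degree_Inl out_degree_Inr)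
  obtain u where "u \<in> U" "deg u = d" by (rule d_attained)
  then show "d \<in> out_degree H ` verts H" by (force simp: verts_H out_degree_Inl)
qed

lemma card_parts:
  assumes "Z \<subseteq> verts H"
  shows "card {u \<in> U. Inl u \<in> Z} + card {v \<in> V. Inr v \<in> Z} = card Z"
proof -
  define A where "A = {u \<in> U. Inl u \<in> Z}"
  define B where "B = {v \<in> V. Inr v \<in> Z}"
  have "Z = Inl ` A \<union> Inr ` B"
  proof (rule set_eqI)
    show "x \<in> Z \<longleftrightarrow> x \<in> Inl ` A \<union> Inr ` B" for x
      using assms by (cases x) (auto simp: A_def B_def verts_H)
  qed
  moreover have "finite A" "finite B" using finite_U finite_V by (auto simp: A_def B_def)
  ultimately have "card Z = card (Inl ` A :: ('a + 'b) set) + card (Inr ` B :: ('a + 'b) set)"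
    by (auto intro: card_Un_disjoint)
  then show ?thesis by (simp add: card_image flip: A_def B_def)
qed

section \<open>Reachability after few deletions\<close>

lemma reachable_V:
  assumes Z: "Z \<subseteq> verts H" "card Z < k"
    and "v \<in> V" "Inr v \<notin> Z" "w \<in> V" "Inr w \<notin> Z"
  shows "Inr v \<rightarrow>\<^sup>*\<^bsub>delete_verts H Z\<^esub> Inr w"
proof (rule ccontr)
  have "Inr v \<in> verts H - Z" using assms by (simp add: verts_H)
  moreover assume "\<not> ?thesis"
  ultimately obtain S where S: "Inr v \<in> S" "Inr w \<notin> S" "S \<subseteq> verts H - Z"
    "\<forall>x y. x \<in> S \<longrightarrow> y \<notin> Z \<longrightarrow> x \<rightarrow>\<^bsub>H\<^esub> y \<longrightarrow> y \<in> S"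
    by (rule H.not_reachable_delete_vertsE)
  define X where "X = {v \<in> V. Inr v \<in> S}"
  define Y where "Y = {v \<in> V. Inr v \<notin> S \<union> Z}"
  have "k \<le> card (\<Union> (N ` X) \<inter> \<Union> (N ` Y)) + card (V - X - Y)"
    using assms S by (intro card_common_neighbours_ge) (auto simp: X_def Y_def)
  also have "\<dots> \<le> card {u \<in> U. Inl u \<in> Z} + card {v \<in> V. Inr v \<in> Z}"
  proof (intro add_mono card_mono)
    \<comment> \<open>A common neighbour of \<open>X\<close> and \<open>Y\<close> outside
      \<open>Z\<close> would carry the closed set \<open>S\<close> from \<open>X\<close> into
      \<open>Y\<close>.\<close>
    show "\<Union> (N ` X) \<inter> \<Union> (N ` Y) \<subseteq> {u \<in> U. Inl u \<in> Z}"
    proof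
      fix u assume "u \<in> \<Union> (N ` X) \<inter> \<Union> (N ` Y)"
      then obtain x y where xy: "x \<in> X" "u \<in> N x" "y \<in> Y" "u \<in> N y" by blast
      then have "Inl u \<in> S" if "Inl u \<notin> Z" using S(4)[rule_format, of "Inr x" "Inl u"] that by (simp add: adj_H X_def)
      moreover have "Inl u \<notin> S" using S(4)[rule_format, of "Inl u" "Inr y"] xy by (auto simp: adj_H Y_def)
      ultimately show "u \<in> {u \<in> U. Inl u \<in> Z}" using xy N_subset by (auto simp: X_def)
    qed
    show "V - X - Y \<subseteq> {v \<in> V. Inr v \<in> Z}" by (auto simp: X_def Y_def)
  qed (use finite_U finite_V in auto)
  finally show False using card_parts[OF Z(1)] Z(2) by simp
qed

lemma reachable_U:
  assumes Z: "Z \<subseteq> verts H" "card Z < d"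
    and "u \<in> U" "Inl u \<notin> Z" "w \<in> U" "Inl w \<notin> Z"
  shows "Inl u \<rightarrow>\<^sup>*\<^bsub>delete_verts H Z\<^esub> Inl w"
proof (rule ccontr)
  have "Inl u \<in> verts H - Z" using assms by (simp add: verts_H)
  moreover assume "\<not> ?thesis"
  ultimately obtain S where S: "Inl u \<in> S" "Inl w \<notin> S" "S \<subseteq> verts H - Z"
    "\<forall>x y. x \<in> S \<longrightarrow> y \<notin> Z \<longrightarrow> x \<rightarrow>\<^bsub>H\<^esub> y \<longrightarrow> y \<in> S"
    by (rule H.not_reachable_delete_vertsE)
  define P where "P = {u \<in> U. Inl u \<in> S}"
  define Q where "Q = {u \<in> U. Inl u \<notin> S \<union> Z}"
  have "d \<le> card {v \<in> V. N v \<inter> P \<noteq> {} \<and> N v \<inter> Q \<noteq> {}} + card (U - P - Q)"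
    using assms S by (intro card_separated_V_ge) (auto simp: P_def Q_def)
  also have "\<dots> \<le> card {v \<in> V. Inr v \<in> Z} + card {u \<in> U. Inl u \<in> Z}"
  proof (intro add_mono card_mono)
    \<comment> \<open>Dually, an undeleted vertex of \<open>V\<close> with neighbours in both parts
      would carry \<open>S\<close> from \<open>P\<close> into \<open>Q\<close>.\<close>
    show "{v \<in> V. N v \<inter> P \<noteq> {} \<and> N v \<inter> Q \<noteq> {}} \<subseteq> {v \<in> V. Inr v \<in> Z}"
    proof
      fix v assume "v \<in> {v \<in> V. N v \<inter> P \<noteq> {} \<and> N v \<inter> Q \<noteq> {}}"
      then obtain p q where pq: "v \<in> V" "p \<in> P" "p \<in> N v" "q \<in> Q" "q \<in> N v" by blast
      then have "Inr v \<in> S" if "Inr v \<notin> Z" using S(4)[rule_format, of "Inl p" "Inr v"] that by (simp add: adj_H P_def)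
      moreover have "Inr v \<notin> S" using S(4)[rule_format, of "Inr v" "Inl q"] pq by (auto simp: adj_H Q_def)
      ultimately show "v \<in> {v \<in> V. Inr v \<in> Z}" using pq by auto
    qed
    show "U - P - Q \<subseteq> {u \<in> U. Inl u \<in> Z}" by (auto simp: P_def Q_def)
  qed (use finite_U finite_V in auto)
  finally show False using card_parts[OF Z(1)] Z(2) by simp
qed

text \<open>Every vertex of \<open>V\<close> has \<open>k + 1\<close> neighbours, more than
  \<open>card Z\<close>, so one survives. Walks can therefore start and end by stepping into and out
  of \<open>U\<close>, where \<open>reachable_U\<close> applies.\<close>

lemma reachable_verts:
  assumes Z: "Z \<subseteq> verts H" "card Z < d" and x: "x \<in> verts H - Z" and y: "y \<in> verts H - Z"
  shows "x \<rightarrow>\<^sup>*\<^bsub>delete_verts H Z\<^esub> y"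
proof -
  interpret D: wf_digraph "delete_verts H Z" by (rule H.wf_digraph_delete_verts)
  have nbr: "\<exists>u\<in>U. Inl u \<notin> Z \<and> u \<in> N v" if "v \<in> V" for v
  proof (rule ccontr)
    assume "\<not> ?thesis"
    then have "N v \<subseteq> {u \<in> U. Inl u \<in> Z}" using N_subset[OF that] by blast
    then have "card (N v) \<le> card {u \<in> U. Inl u \<in> Z}" using finite_U by (intro card_mono) auto
    then show False using card_parts[OF Z(1)] Z(2) d_le_k card_N_eq[OF that] by linarith
  qed
  have from_U: "\<exists>u\<in>U. Inl u \<notin> Z \<and> Inl u \<rightarrow>\<^sup>*\<^bsub>delete_verts H Z\<^esub> z" if z: "z \<in> verts H - Z" for z
  proof (cases z)
    case (Inl u)
    then show ?thesis using z D.reachable_refl[of z] by (auto simp: verts_H)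
  next
    case (Inr v)
    then obtain u where "u \<in> U" "Inl u \<notin> Z" "u \<in> N v" using nbr z by (auto simp: verts_H)
    then show ?thesis using z Inr D.reachable_adjI[of "Inl u" z]
      by (auto simp: verts_H H.dominates_delete_verts_iff adj_H)
  qed
  have to_U: "\<exists>u\<in>U. Inl u \<notin> Z \<and> z \<rightarrow>\<^sup>*\<^bsub>delete_verts H Z\<^esub> Inl u" if z: "z \<in> verts H - Z" for z
  proof (cases z)
    case (Inl u)
    then show ?thesis using z D.reachable_refl[of z] by (auto simp: verts_H)
  next
    case (Inr v)
    then obtain u where "u \<in> U" "Inl u \<notin> Z" "u \<in> N v" using nbr z by (auto simp: verts_H)
    then show ?thesis using z Inr D.reachable_adjI[of z "Inl u"]
      by (auto simp: verts_H H.dominates_delete_verts_iff adj_H)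
  qed
  obtain u where u: "u \<in> U" "Inl u \<notin> Z" "x \<rightarrow>\<^sup>*\<^bsub>delete_verts H Z\<^esub> Inl u" using to_U[OF x] by blast
  obtain w where w: "w \<in> U" "Inl w \<notin> Z" "Inl w \<rightarrow>\<^sup>*\<^bsub>delete_verts H Z\<^esub> y" using from_U[OF y] by blast
  show ?thesis
    using D.reachable_trans[OF D.reachable_trans[OF u(3) reachable_U[OF Z u(1,2) w(1,2)]] w(3)] .
qed

text \<open>The case of no deletions. It provides the clause of \<open>vertex_cut\<close> that both
  vertices lie in one component.\<close>

lemma reachable_H: "x \<in> verts H \<Longrightarrow> y \<in> verts H \<Longrightarrow> x \<rightarrow>\<^sup>*\<^bsub>H\<^esub> y"
  using reachable_verts[of "{}" x y] d_pos by (simp add: H.wf_digraph_axioms)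

section \<open>Cuts formed by neighbourhoods and the connectivity values\<close>

lemma vertex_cut_neighbours:
  assumes "x \<in> verts H" "y \<in> verts H" "x \<noteq> y" "\<not> x \<rightarrow>\<^bsub>H\<^esub> y" "\<not> x \<rightarrow>\<^bsub>H\<^esub> x"
  shows "vertex_cut H x y {z. x \<rightarrow>\<^bsub>H\<^esub> z}"
  unfolding vertex_cut_def
  using assms reachable_H H.not_reachable_delete_neighbours H.adj_in_verts(2) by blast

lemma set_connectivity_V_ge: "enat k \<le> set_connectivity H (Inr ` V)"
proof (rule set_connectivity_ge)
  fix x y Z assume "x \<in> Inr ` V" "y \<in> Inr ` V" "vertex_cut H x y Z"
  then show "k \<le> card Z" using reachable_V[of Z] not_less unfolding vertex_cut_def by blast
qed

lemma set_connectivity_V_le: "set_connectivity H (Inr ` V) \<le> enat (k + 1)"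
proof -
  obtain v w where vw: "v \<in> V" "w \<in> V" "v \<noteq> w"
    using card_V card_le_Suc0_iff_eq[OF finite_V] by force
  then have "vertex_cut H (Inr v) (Inr w) (Inl ` N v)"
    using vertex_cut_neighbours[of "Inr v" "Inr w"] by (simp add: verts_H adj_H neighbours_Inr)
  then have "set_connectivity H (Inr ` V) \<le> enat (card (Inl ` N v :: ('a + 'b) set))"
    using vw by (intro set_connectivity_le) auto
  then show ?thesis using card_N_eq[OF vw(1)] by (simp add: card_image)
qed

lemma set_connectivity_V: "set_connectivity H (Inr ` V) \<in> {enat k, enat (k + 1)}"
proof -
  \<comment> \<open>The upper bound rules out an infinite value.\<close>
  obtain c where "set_connectivity H (Inr ` V) = enat c"
    using set_connectivity_V_le enat_ile by blast
  then show ?thesis using set_connectivity_V_ge set_connectivity_V_le by auto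
qed

text \<open>Isolating a vertex of minimum degree gives the upper bound both for the set connectivity
  of \<open>U\<close> and for the connectivity of the whole graph.\<close>

lemma min_degree_cut:
  obtains u w where "u \<in> U" "w \<in> U" "vertex_cut H (Inl u) (Inl w) (Inr ` {v \<in> V. u \<in> N v})"
    "card (Inr ` {v \<in> V. u \<in> N v} :: ('a + 'b) set) = d"
proof -
  obtain u where u: "u \<in> U" "deg u = d" by (rule d_attained)
  have "\<not> card U \<le> Suc 0" using card_U card_V by simp
  then obtain w where w: "w \<in> U" "u \<noteq> w"
    using card_le_Suc0_iff_eq[OF finite_U] u(1) by metis
  have "vertex_cut H (Inl u) (Inl w) (Inr ` {v \<in> V. u \<in> N v})"
    using vertex_cut_neighbours[of "Inl u" "Inl w"] u w
    by (simp add: verts_H adj_H neighbours_Inl)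
  then show thesis using that u w by (simp add: card_image deg_def)
qed

lemma set_connectivity_U: "set_connectivity H (Inl ` U) = enat d"
proof (rule antisym)
  obtain u w where uw: "u \<in> U" "w \<in> U"
    "vertex_cut H (Inl u) (Inl w) (Inr ` {v \<in> V. u \<in> N v})"
    "card (Inr ` {v \<in> V. u \<in> N v} :: ('a + 'b) set) = d" by (rule min_degree_cut)
  show "set_connectivity H (Inl ` U) \<le> enat d"
    using set_connectivity_le[OF imageI[OF uw(1)] imageI[OF uw(2)] uw(3)] unfolding uw(4) .
  show "enat d \<le> set_connectivity H (Inl ` U)"
  proof (rule set_connectivity_ge)
    fix x y Z assume "x \<in> Inl ` U" "y \<in> Inl ` U" "vertex_cut H x y Z"
    then show "d \<le> card Z" using reachable_U[of Z] not_less unfolding vertex_cut_def by blast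
  qed
qed

text \<open>For \<open>t > d\<close> the cut from \<open>min_degree_cut\<close> is small enough to
  contradict \<open>t\<close>-connectedness; for \<open>t \<le> d\<close> fewer than
  \<open>d\<close> deletions leave all remaining vertices mutually reachable.\<close>

lemma t_connected_H_iff: "t_connected t H \<longleftrightarrow> t \<le> d"
proof
  assume t: "t_connected t H"
  show "t \<le> d"
  proof (rule ccontr)
    assume "\<not> t \<le> d"
    obtain u w where "u \<in> U" "w \<in> U"
      and uw: "vertex_cut H (Inl u) (Inl w) (Inr ` {v \<in> V. u \<in> N v})"
      "card (Inr ` {v \<in> V. u \<in> N v} :: ('a + 'b) set) = d" by (rule min_degree_cut)
    from uw have "Digraph_Component.connected (delete_verts H (Inr ` {v \<in> V. u \<in> N v}))"
      using t \<open>\<not> t \<le> d\<close> unfolding t_connected_def vertex_cut_def by auto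
    then show False using uw(1) unfolding H.connected_delete_verts_iff vertex_cut_def by blast
  qed
next
  assume t: "t \<le> d"
  have "card U \<le> card (verts H)"
    using card_mono[of "verts H" "Inl ` U"] finite_U finite_V by (simp add: verts_H card_image)
  then have card: "d < card (verts H)" using d_le_k card_U card_V by linarith
  show "t_connected t H"
    unfolding t_connected_def
  proof (intro conjI allI impI)
    show "t < card (verts H)" using t card by simp
    fix Z assume Z: "Z \<subseteq> verts H" "card Z < t"
    then have "card Z < card (verts H)" using \<open>t < card (verts H)\<close> by simp
    then have "verts H - Z \<noteq> {}" using Z(1) by auto
    then show "Digraph_Component.connected (delete_verts H Z)"
      unfolding H.connected_delete_verts_iff using reachable_verts[of Z] Z t by auto
  qed
qed

lemma connectivity_H: "connectivity H = d"
  unfolding connectivity_def t_connected_H_iff by (intro Max_eqI) auto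

end

section \<open>Arcs on a cycle\<close>

text \<open>The sumset of \<open>X\<close> and {-k, ..., 0} in the integers modulo \<open>n\<close>,
  represented by naturals below \<open>n\<close>; integer subtraction avoids truncation at
  0.\<close>

definition shifts :: "nat \<Rightarrow> nat \<Rightarrow> nat set \<Rightarrow> nat set" where
  "shifts n k X = {nat ((int x - int b) mod int n) | x b. x \<in> X \<and> b \<le> k}"

text \<open>One more shift adds just the predecessors of the points already present. This drives the
  induction on \<open>k\<close>.\<close>

lemma shifts_Suc:
  assumes "0 < n"
  shows "shifts n (Suc k) X = shifts n k X \<union> (\<lambda>y. nat ((int y - 1) mod int n)) ` shifts n k X"
proof -
  have pred: "nat ((int (nat ((int x - int b) mod int n)) - 1) mod int n)
      = nat ((int x - int (Suc b)) mod int n)" for x b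
    using assms by (simp add: mod_diff_left_eq algebra_simps)
  show ?thesis
  proof (intro equalityI subsetI)
    fix y assume "y \<in> shifts n (Suc k) X"
    then obtain x b where xb: "y = nat ((int x - int b) mod int n)" "x \<in> X" "b \<le> Suc k"
      by (auto simp: shifts_def)
    show "y \<in> shifts n k X \<union> (\<lambda>y. nat ((int y - 1) mod int n)) ` shifts n k X"
    proof (cases "b \<le> k")
      case True
      then show ?thesis using xb by (auto simp: shifts_def)
    next
      case False
      then have "b = Suc k" using xb by simp
      then have "y = nat ((int (nat ((int x - int k) mod int n)) - 1) mod int n)"
        using xb pred by simp
      then show ?thesis using xb(2) unfolding shifts_def by blast
    qed
  next
    fix y assume "y \<in> shifts n k X \<union> (\<lambda>y. nat ((int y - 1) mod int n)) ` shifts n k X"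
    then show "y \<in> shifts n (Suc k) X"
    proof
      assume "y \<in> shifts n k X"
      then show ?thesis unfolding shifts_def using le_SucI by blast
    next
      assume "y \<in> (\<lambda>y. nat ((int y - 1) mod int n)) ` shifts n k X"
      then obtain x b where "x \<in> X" "b \<le> k"
        "y = nat ((int (nat ((int x - int b) mod int n)) - 1) mod int n)"
        by (auto simp: shifts_def)
      then have "x \<in> X" "Suc b \<le> Suc k" "y = nat ((int x - int (Suc b)) mod int n)"
        by (simp_all only: pred Suc_le_mono)
      then show ?thesis unfolding shifts_def by blast
    qed
  qed
qed

lemma shifts_subset: "0 < n \<Longrightarrow> shifts n k X \<subseteq> {..<n}"
  by (auto simp: shifts_def nat_less_iff)

lemma pred_closed_eq_UNIV:
  assumes "0 < n" and sub: "A \<subseteq> {..<n}" and "A \<noteq> {}"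
    and closed: "(\<lambda>y. nat ((int y - 1) mod int n)) ` A \<subseteq> A"
  shows "A = {..<n}"
proof (rule antisym[OF sub], rule subsetI)
  fix y assume "y \<in> {..<n}"
  obtain x where x: "x \<in> A" using assms by blast
  then have "x < n" using sub by auto
  have iter: "nat ((int x - int i) mod int n) \<in> A" for i
  proof (induction i)
    case 0
    then show ?case using x \<open>x < n\<close> by simp
  next
    case (Suc i)
    have "nat ((int x - int (Suc i)) mod int n)
        = nat ((int (nat ((int x - int i) mod int n)) - 1) mod int n)"
      using assms(1) by (simp add: mod_diff_left_eq algebra_simps)
    then show ?case using Suc closed by auto
  qed
  \<comment> \<open>Going back \<open>x + n - y\<close> steps from \<open>x\<close> ends at
    \<open>y\<close> modulo \<open>n\<close>; the summand \<open>n\<close> keeps the number of steps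
    a natural number.\<close>
  have "int x - int (x + n - y) = int y - int n" using \<open>y \<in> {..<n}\<close> by simp
  then have "nat ((int x - int (x + n - y)) mod int n) = y" using \<open>y \<in> {..<n}\<close> by simp
  then show "y \<in> A" using iter by metis
qed

text \<open>The Cauchy--Davenport inequality for an interval: a proper nonempty subset of the cycle is
  not closed under predecessors, so each further shift gains a point.\<close>

lemma card_shifts_ge:
  assumes "0 < n" "X \<subseteq> {..<n}" "X \<noteq> {}"
  shows "min n (card X + k) \<le> card (shifts n k X)"
proof (induction k)
  case 0
  have "shifts n 0 X = X" using assms(2) by (force simp: shifts_def)
  then show ?case by simp
next
  case (Suc k)
  let ?A = "shifts n k X"
  have fin: "finite ?A" "finite (shifts n (Suc k) X)"
    using shifts_subset[OF assms(1)] finite_subset by blast+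
  have ne: "?A \<noteq> {}" using assms(3) by (auto simp: shifts_def)
  have sub: "?A \<subseteq> shifts n (Suc k) X" using shifts_Suc[OF assms(1)] by blast
  show ?case
  proof (cases "?A = {..<n}")
    case True
    then show ?thesis using card_mono[OF fin(2) sub] by simp
  next
    case False
    then have "?A \<noteq> shifts n (Suc k) X"
      using pred_closed_eq_UNIV[OF assms(1) shifts_subset[OF assms(1)] ne] shifts_Suc[OF assms(1)] by blast
    then have "card ?A < card (shifts n (Suc k) X)"
      using sub fin by (intro psubset_card_mono) auto
    then show ?thesis using Suc by linarith
  qed
qed

section \<open>Neighbourhoods in \<open>G_bar\<close>\<close>

definition nbr :: "nat \<Rightarrow> nat \<Rightarrow> nat \<Rightarrow> nat set" where
  "nbr n m j = shifts n (n - m) {j * n div m}"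

text \<open>Reduces expansion of neighbourhoods to \<open>card_shifts_ge\<close> for the set of
  interval endpoints.\<close>

lemma UN_nbr: "\<Union> (nbr n m ` X) = shifts n (n - m) ((\<lambda>j. j * n div m) ` X)"
  by (auto simp: nbr_def shifts_def)

lemma E_bar_eq: "E_bar n m = {(Inl i, Inr j) | i j. j \<in> {..<m} \<and> i \<in> nbr n m j}"
proof -
  have "\<lfloor>real (j * n) / real m\<rfloor> = int (j * n div m)" for j
    by (rule floor_divide_of_nat_eq)
  then show ?thesis
    unfolding E_bar_def nbr_def shifts_def by (auto simp: less_Suc_eq_le)
qed

text \<open>As \<open>m \<le> n\<close>, raising \<open>j\<close> by one adds at least
  \<open>m\<close> to the dividend, so the quotient strictly increases.\<close>

lemma inj_on_div_steps:
  fixes m n :: nat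
  assumes "0 < m" "m \<le> n"
  shows "inj_on (\<lambda>j. j * n div m) {..<m}"
proof -
  have "j * n div m < Suc j * n div m" for j
  proof -
    have "j * n div m < (j * n + m) div m" using assms(1) by simp
    also have "\<dots> \<le> Suc j * n div m" using assms(2) by (intro div_le_mono) simp
    finally show ?thesis .
  qed
  then have "strict_mono (\<lambda>j. j * n div m)" by (simp add: strict_mono_Suc_iff)
  then show ?thesis using strict_mono_imp_inj_on inj_on_subset by blast
qed

lemma expanding_bipartite_nbr:
  assumes "1 < m" "m < n"
  shows "expanding_bipartite {..<n} {..<m} (nbr n m) (n - m)"
proof
  show "card (nbr n m j) \<le> n - m + 1" for j
  proof -
    have "nbr n m j = (\<lambda>b. nat ((int (j * n div m) - int b) mod int n)) ` {..n - m}"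
      by (auto simp: nbr_def shifts_def)
    then show ?thesis using card_image_le[of "{..n - m}"] by simp
  qed
  fix X assume X: "X \<subseteq> {..<m}" "X \<noteq> {}"
  let ?P = "(\<lambda>j. j * n div m) ` X"
  have "card ?P = card X"
    using X assms inj_on_div_steps[of m n] by (intro card_image) (auto intro: inj_on_subset)
  moreover have "?P \<subseteq> {..<n}"
    using X assms by (auto simp: div_less_iff_less_mult mult.commute)
  ultimately show "min (card {..<n}) (card X + (n - m)) \<le> card (\<Union> (nbr n m ` X))"
    using card_shifts_ge[of n ?P "n - m"] X assms by (simp add: UN_nbr)
qed (use assms shifts_subset in \<open>auto simp: nbr_def\<close>)

text \<open>The case \<open>k = 1\<close>: each interval consists of \<open>j\<close> and its cyclic
  predecessor, which wraps to \<open>m\<close> at \<open>j = 0\<close>.\<close>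

lemma nbr_Suc:
  assumes "j < m"
  shows "nbr (Suc m) m j = {j, if j = 0 then m else j - 1}"
proof -
  \<comment> \<open>The dividend is \<open>j * m + j\<close> with remainder
    \<open>j < m\<close>.\<close>
  have "j * Suc m div m = j"
    using assms by simp
  then have "nbr (Suc m) m j = {nat ((int j - int b) mod int (Suc m)) | b. b \<le> 1}"
    by (auto simp: nbr_def shifts_def)
  also have "\<dots> = {nat (int j mod int (Suc m)), nat ((int j - 1) mod int (Suc m))}"
    by (auto simp: le_Suc_eq intro: exI[of _ 0] exI[of _ 1])
  also have "nat (int j mod int (Suc m)) = j" using assms by simp
  also have "nat ((int j - 1) mod int (Suc m)) = (if j = 0 then m else j - 1)"
  proof (cases "j = 0")
    case True
    then show ?thesis by (simp add: zmod_minus1)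
  next
    case False
    then have "(int j - 1) mod int (Suc m) = int j - 1"
      using assms by (intro mod_pos_pos_trivial) auto
    then show ?thesis using False by simp
  qed
  finally show ?thesis .
qed

theorem corollary5p4:
  fixes n m k :: nat
  assumes "1 < m" and "m < n" and "k = n - m"
  shows "set_connectivity (G_bar n m) (V_class m) \<in> {enat k, enat (k + 1)}
       \<and> set_connectivity (G_bar n m) (U_class n) = enat (min_degree_on (G_bar n m) (U_class n))
       \<and> connectivity (G_bar n m) = min_degree (G_bar n m)
       \<and> (k = 1 \<longrightarrow> set_connectivity (G_bar n m) (V_class m) = enat k)"
proof -
  interpret expanding_bipartite "{..<n}" "{..<m}" "nbr n m" k
    unfolding assms(3) by (rule expanding_bipartite_nbr[OF assms(1,2)])
  have G: "G_bar n m = H"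
    unfolding G_bar_def H_def edges_def E_bar_eq U_class_def V_class_def by simp
  have "set_connectivity H (Inr ` {..<m}) \<le> enat 1" if "k = 1"
  proof -
    have "n = Suc m" using that assms by simp
    then have nbr: "nbr n m j = {j, if j = 0 then m else j - 1}" if "j < m" for j
      using nbr_Suc[OF that] by simp
    txt \<open>The graph is a path starting with \<open>u\<^sub>m, v\<^sub>0, u\<^sub>0, v\<^sub>1\<close>.\<close>
    have "\<not> Inr 0 \<rightarrow>\<^sup>*\<^bsub>delete_verts H {Inl 0}\<^esub> Inr 1"
    proof
      assume "Inr 0 \<rightarrow>\<^sup>*\<^bsub>delete_verts H {Inl 0}\<^esub> Inr 1"
      \<comment> \<open>Apart from the deleted \<open>Inl 0\<close>, the only neighbour of
        \<open>Inr 0\<close> is \<open>Inl m\<close>; and \<open>Inl m\<close> is adjacent to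
        \<open>Inr 0\<close> alone, since the other intervals stay below \<open>m\<close>.\<close>
      then have "Inr 1 \<in> {Inr 0, Inl m :: nat + nat}"
      proof (rule H.reachable_delete_verts_closed)
        fix x y :: "nat + nat"
        assume "x \<in> {Inr 0, Inl m}" "y \<notin> {Inl 0}" "x \<rightarrow>\<^bsub>H\<^esub> y"
        then show "y \<in> {Inr 0, Inl m}"
          using assms(1) by (cases y) (auto simp: adj_H nbr split: if_splits)
      qed simp
      then show False by simp
    qed
    then have "vertex_cut H (Inr 0) (Inr 1) {Inl 0}"
      using assms(1,2) reachable_H[of "Inr 0" "Inr 1"] by (auto simp: vertex_cut_def verts_H)
    then show ?thesis
      using set_connectivity_le[of "Inr 0" "Inr ` {..<m}" "Inr 1"] assms(1) by fastforce
  qed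
  \<comment> \<open>For \<open>k = 1\<close> this cut of size 1 meets the general lower bound
    \<open>k\<close>.\<close>
  then show ?thesis
    using set_connectivity_V set_connectivity_V_ge set_connectivity_U min_degree_on_U
      connectivity_H min_degree_H
    unfolding G U_class_def V_class_def by (auto intro: antisym)
qed

end
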